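(* Let $z, w \in \mathbb{C}$ with $|z| = |w| = 1$. The representations $\pi^z$ and $\pi^w$ of $\mathbb{Z}$ on $\mathbb{C}$ are additive conjugates if and only if either both $z$ and $w$ are not algebraic numbers, or they are both algebraic numbers and are Galois conjugates.
   Context: For $z \in \mathbb{C}$ with $|z| = 1$, $\pi^z$ denotes the one-dimensional unitary representation of $\mathbb{Z}$ on $\mathbb{C}$ given by $\pi^z_n x = z^n x$ for $n \in \mathbb{Z}$, $x \in \mathbb{C}$. Two representations $\pi$ on $\mathcal{H}$ and $\pi'$ on $\mathcal{H}'$ of a group $G$ are additive conjugates if there exists a bijection $\xi \colon \mathcal{H} \to \mathcal{H}'$, not necessarily continuous or linear, such that $\xi(v+w) = \xi(v)+\xi(w)$ and $\xi(\pi_g v) = \pi'_g \xi(v)$ for all $v,w \in \mathcal{H}$ and $g \in G$. Algebraic means algebraic over $\mathbb{Q}$; two algebraic numbers are Galois conjugates if they have the same minimal polynomial over $\mathbb{Q}$. *)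

theory Defs
  imports Complex_Main "HOL-Computational_Algebra.Computational_Algebra"
begin

definition int_rep :: "complex \<Rightarrow> int \<Rightarrow> complex \<Rightarrow> complex" where
  "int_rep z n x = z powi n * x"

lemma int_rep_unitary:
  assumes "norm z = 1"
  shows "int_rep z 0 = id"
    and "int_rep z (m + n) = int_rep z m \<circ> int_rep z n"
    and "int_rep z n (a * x + y) = a * int_rep z n x + int_rep z n y"
    and "int_rep z n x * cnj (int_rep z n y) = x * cnj y"
    and "surj (int_rep z n)"
proof -
  have nz: "z \<noteq> 0" using assms by auto
  show id: "int_rep z 0 = id" by (auto simp: int_rep_def)
  show add: "int_rep z (m + n) = int_rep z m \<circ> int_rep z n" for m n
    using nz by (auto simp: int_rep_def power_int_add)
  show "int_rep z n (a * x + y) = a * int_rep z n x + int_rep z n y"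
    by (simp add: int_rep_def algebra_simps)
  have "(z powi n) * cnj (z powi n) = 1"
    using complex_norm_square[of "z powi n"] assms by (simp add: norm_power_int)
  then show "int_rep z n x * cnj (int_rep z n y) = x * cnj y"
    unfolding int_rep_def complex_cnj_mult by (metis mult.assoc mult.left_commute mult_1)
  show "surj (int_rep z n)"
    using add[of n "- n"] id by (metis add.right_inverse comp_apply id_apply surjI)
qed

text \<open>The acting group is written additively; \<^class>\<open>group_add\<close> does not assume commutativity.
  Only the additive structure of the two spaces enters.\<close>

definition additive_conjugates ::
  "('g::group_add \<Rightarrow> 'h::ab_group_add \<Rightarrow> 'h) \<Rightarrow> ('g \<Rightarrow> 'k::ab_group_add \<Rightarrow> 'k) \<Rightarrow> bool" where
  "additive_conjugates \<pi> \<pi>' \<longleftrightarrow>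
     (\<exists>\<xi>. bij \<xi> \<and> (\<forall>v w. \<xi> (v + w) = \<xi> v + \<xi> w) \<and> (\<forall>g v. \<xi> (\<pi> g v) = \<pi>' g (\<xi> v)))"

definition is_min_poly :: "rat poly \<Rightarrow> 'a::field_char_0 \<Rightarrow> bool" where
  "is_min_poly p x \<longleftrightarrow>
     lead_coeff p = 1 \<and> poly (map_poly of_rat p) x = 0 \<and>
     (\<forall>q. q \<noteq> 0 \<and> poly (map_poly of_rat q) x = 0 \<longrightarrow> degree p \<le> degree q)"

text \<open>Unspecified when \<^term>\<open>x\<close> is not algebraic.\<close>

definition min_poly :: "'a::field_char_0 \<Rightarrow> rat poly" where
  "min_poly x = (THE p. is_min_poly p x)"

definition galois_conjugates :: "'a::field_char_0 \<Rightarrow> 'a \<Rightarrow> bool" where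
  "galois_conjugates x y \<longleftrightarrow> algebraic x \<and> algebraic y \<and> min_poly x = min_poly y"

lemma is_min_poly_unique:
  assumes "is_min_poly p x" "is_min_poly q x"
  shows "p = q"
proof (rule ccontr)
  assume "p \<noteq> q"
  have deg: "degree p = degree q"
    using assms unfolding is_min_poly_def by (metis antisym leading_coeff_0_iff zero_neq_one)
  have "map_poly of_rat (p - q) = (map_poly of_rat p - map_poly of_rat q :: 'a poly)"
    by (intro poly_eqI) (simp add: coeff_map_poly of_rat_diff)
  then have "poly (map_poly of_rat (p - q)) x = 0"
    using assms by (simp add: is_min_poly_def)
  with \<open>p \<noteq> q\<close> have le: "degree p \<le> degree (p - q)"
    using assms(1) unfolding is_min_poly_def by (metis eq_iff_diff_eq_0)
  have "coeff (p - q) (degree p) = 0"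
    using assms deg by (simp add: is_min_poly_def)
  moreover have "degree (p - q) \<le> degree p"
    using deg by (simp add: degree_diff_le)
  ultimately have "lead_coeff (p - q) = 0" using le by simp
  with \<open>p \<noteq> q\<close> show False
    by (metis leading_coeff_0_iff right_minus_eq)
qed

lemma is_min_poly_exists:
  fixes x :: "'a::field_char_0"
  assumes "algebraic x"
  shows "\<exists>p. is_min_poly p x"
proof -
  let ?P = "\<lambda>q::rat poly. q \<noteq> 0 \<and> poly (map_poly of_rat q) x = 0"
  obtain r :: "'a poly" where r: "\<And>i. coeff r i \<in> \<rat>" "r \<noteq> 0" "poly r x = 0"
    using assms by (auto simp: algebraic_altdef)
  obtain r' where "r = map_poly of_rat r'"
    using r(1) ratpolyE by blast
  with r have "?P r'" by auto
  then obtain q where q: "?P q" "\<And>s. ?P s \<Longrightarrow> degree q \<le> degree s"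
    using exists_least_iff[of "\<lambda>n. \<exists>q. ?P q \<and> degree q = n"] by (metis not_le_imp_less)
  let ?p = "smult (inverse (lead_coeff q)) q"
  have "map_poly of_rat ?p
      = smult (of_rat (inverse (lead_coeff q))) (map_poly of_rat q :: 'a poly)"
    by (intro poly_eqI) (simp add: coeff_map_poly of_rat_mult)
  then have "is_min_poly ?p x"
    using q by (auto simp: is_min_poly_def)
  then show ?thesis by blast
qed

lemma is_min_poly_min_poly:
  "algebraic x \<Longrightarrow> is_min_poly (min_poly x) x"
  unfolding min_poly_def using is_min_poly_exists is_min_poly_unique by (metis theI)

end

theory Submission
  imports Defs "HOL-Analysis.Continuum_Not_Denumerable"
begin

text \<open>Both sides of the equivalence say that \<open>z\<close> and \<open>w\<close> are roots of the same rational polynomials.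
  An additive conjugation \<open>\<xi>\<close> satisfies \<open>\<xi> (p(z) v) = p(w) \<xi> v\<close> for every rational polynomial \<open>p\<close>, so
  injectivity gives \<open>p(z) = 0 \<longleftrightarrow> p(w) = 0\<close>. Conversely, this equivalence makes
  \<open>p(z) / q(z) \<mapsto> p(w) / q(w)\<close> a well-defined field isomorphism from \<open>\<rat>(z)\<close> to \<open>\<rat>(w)\<close>. Both fields
  are countable, so the complex numbers have bases over each of them of the cardinality of the
  continuum, and a bijection between the bases extends to a semilinear bijection of the complex numbers.\<close>

subsection \<open>Bases over a subfield\<close>

locale subfield =
  fixes K :: "'a::field set"
  assumes one_mem: "1 \<in> K"
    and diff_mem: "x \<in> K \<Longrightarrow> y \<in> K \<Longrightarrow> x - y \<in> K"
    and mult_mem: "x \<in> K \<Longrightarrow> y \<in> K \<Longrightarrow> x * y \<in> K"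
    and inverse_mem: "x \<in> K \<Longrightarrow> inverse x \<in> K"
begin

lemma zero_mem: "0 \<in> K"
  using diff_mem[OF one_mem one_mem] by simp

lemma uminus_mem: "x \<in> K \<Longrightarrow> - x \<in> K"
  using diff_mem[OF zero_mem] by simp

lemma add_mem: "x \<in> K \<Longrightarrow> y \<in> K \<Longrightarrow> x + y \<in> K"
  using diff_mem[OF _ uminus_mem, of x y] by simp

lemma divide_mem: "x \<in> K \<Longrightarrow> y \<in> K \<Longrightarrow> x / y \<in> K"
  by (simp add: divide_inverse mult_mem inverse_mem)

text \<open>Linear independence in the ambient field viewed as a vector space over \<open>K\<close>;
  the scalars are confined to \<open>K\<close> explicitly because \<open>K\<close> is a set, not a
  type.\<close>

definition indep :: "'a set \<Rightarrow> bool" where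
  "indep B \<longleftrightarrow> (\<forall>F c. finite F \<and> F \<subseteq> B \<and> c ` F \<subseteq> K \<and> (\<Sum>b\<in>F. c b * b) = 0 \<longrightarrow> (\<forall>b\<in>F. c b = 0))"

lemma indepD:
  "indep B \<Longrightarrow> finite F \<Longrightarrow> F \<subseteq> B \<Longrightarrow> c ` F \<subseteq> K \<Longrightarrow> (\<Sum>b\<in>F. c b * b) = 0 \<Longrightarrow> b \<in> F \<Longrightarrow> c b = 0"
  unfolding indep_def by blast

text \<open>Zorn's lemma applies because a linear relation involves only finitely many elements, and
  a finite subset of the union of a nonempty chain already lies in one member.\<close>

lemma maximal_indep_exists:
  obtains B where "indep B" "\<And>B'. indep B' \<Longrightarrow> B \<subseteq> B' \<Longrightarrow> B' = B"
proof -
  have "\<exists>B\<in>{B. indep B}. \<forall>B'\<in>{B. indep B}. B \<subseteq> B' \<longrightarrow> B' = B"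
  proof (rule subset_Zorn')
    fix C assume C: "subset.chain {B. indep B} C"
    show "\<Union>C \<in> {B. indep B}"
    proof (cases "C = {}")
      case True
      then show ?thesis by (simp add: indep_def)
    next
      case False
      have "c b = 0" if F: "finite F" "F \<subseteq> \<Union>C" "c ` F \<subseteq> K" "(\<Sum>b\<in>F. c b * b) = 0" "b \<in> F" for F c b
      proof -
        obtain B where B: "B \<in> C" "F \<subseteq> B"
          using finite_subset_Union_chain[OF F(1,2) False C] by blast
        with C have "indep B" by (auto simp: subset.chain_def)
        from indepD[OF this F(1) B(2) F(3-5)] show ?thesis .
      qed
      then show ?thesis unfolding indep_def by blast
    qed
  qed
  with that show thesis by blast
qed

text \<open>For \<open>x\<close> outside \<open>B\<close>, maximality yields a nontrivial relation
  on \<open>insert x B\<close>; independence of \<open>B\<close> forces \<open>x\<close> to occur in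
  it, so the relation can be solved for \<open>x\<close>.\<close>

lemma maximal_indep_spans:
  assumes B: "indep B" and max: "\<And>B'. indep B' \<Longrightarrow> B \<subseteq> B' \<Longrightarrow> B' = B"
  obtains F c where "finite F" "F \<subseteq> B" "c ` F \<subseteq> K" "x = (\<Sum>b\<in>F. c b * b)"
proof (cases "x \<in> B")
  case True
  show thesis by (rule that[of "{x}" "\<lambda>_. 1"]) (use True one_mem in auto)
next
  case False
  then have "\<not> indep (insert x B)" using max by blast
  then obtain F c y where F: "finite F" "F \<subseteq> insert x B" "c ` F \<subseteq> K" "(\<Sum>b\<in>F. c b * b) = 0"
    and y: "y \<in> F" "c y \<noteq> 0"
    unfolding indep_def by blast
  \<comment> \<open>Otherwise dropping \<open>x\<close> leaves a relation inside \<open>B\<close>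
    whose coefficient at \<open>y\<close> is still nonzero.\<close>
  have x: "x \<in> F \<and> c x \<noteq> 0"
  proof (rule ccontr)
    assume contra: "\<not> ?thesis"
    then have "(\<Sum>b\<in>F - {x}. c b * b) = 0"
      using F(1,4) by (cases "x \<in> F") (auto simp: sum.remove)
    with B F y contra show False
      using indepD[of B "F - {x}" c y] by auto
  qed
  have "c x * x = - (\<Sum>b\<in>F - {x}. c b * b)"
    using F x by (simp add: sum.remove[of F x] eq_neg_iff_add_eq_0)
  then have "x = - (\<Sum>b\<in>F - {x}. c b * b) / c x"
    using x by (metis nonzero_mult_div_cancel_left)
  also have "\<dots> = (\<Sum>b\<in>F - {x}. (- c b / c x) * b)"
    by (simp add: sum_divide_distrib sum_negf)
  finally have eq: "x = (\<Sum>b\<in>F - {x}. (- c b / c x) * b)" .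
  show thesis
  proof (rule that[of "F - {x}" "\<lambda>b. - c b / c x", OF _ _ _ eq])
    show "(\<lambda>b. - c b / c x) ` (F - {x}) \<subseteq> K"
      using F(3) x by (auto intro!: divide_mem uminus_mem)
  qed (use F in auto)
qed

end

section \<open>Cardinality of spans over countable coefficient sets\<close>

unbundle cardinal_syntax

lemma countable_iff_card_of_nat: "countable A \<longleftrightarrow> |A| \<le>o |UNIV :: nat set|"
  unfolding countable_def by (simp flip: card_of_ordLeq)

text \<open>The span is covered by countably many levels, sorted by the number of summands, and
  cardinal arithmetic with infinite \<open>B\<close> and countable \<open>K\<close> bounds each
  level by \<open>|B|\<close>.\<close>

lemma card_of_span_le:
  fixes B :: "'a::semiring_1 set"
  assumes "infinite B" "countable K"
    and span: "\<And>x. x \<in> S \<Longrightarrow> \<exists>F c. finite F \<and> F \<subseteq> B \<and> c ` F \<subseteq> K \<and> x = (\<Sum>b\<in>F. c b * b)"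
  shows "|S| \<le>o |B|"
proof -
  \<comment> \<open>\<open>U n\<close> collects the sums of exactly \<open>n\<close> terms
    \<open>k * b\<close> with \<open>k\<close> in \<open>K\<close> and \<open>b\<close> in
    \<open>B\<close>, repetitions allowed.\<close>
  define U where "U n = ((\<lambda>S. (\<lambda>(k, b, s). k * b + s) ` (K \<times> B \<times> S)) ^^ n) {0}" for n
  have K: "|K| \<le>o |B|"
    using assms(1,2) unfolding countable_iff_card_of_nat infinite_iff_card_of_nat
    by (rule ordLeq_transitive[rotated])
  have U: "|U n| \<le>o |B|" for n
  proof (induction n)
    case 0
    then show ?case
      using assms(1) by (auto simp: U_def intro: card_of_singl_ordLeq)
  next
    case (Suc n)
    have "|K \<times> B \<times> U n| \<le>o |B|"
      using assms(1) K Suc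
      by (intro card_of_Times_ordLeq_infinite_Field card_of_Card_order) (auto simp: Field_card_of card_of_mono1)
    then show ?case
      using card_of_image ordLeq_transitive by (fastforce simp: U_def)
  qed
  have sum_U: "(\<Sum>b\<in>F. c b * b) \<in> U (card F)" if "finite F" "F \<subseteq> B" "c ` F \<subseteq> K" for F c
    using that
  proof (induction F)
    case empty
    then show ?case by (simp add: U_def)
  next
    case (insert b F)
    then have "(c b, b, \<Sum>b\<in>F. c b * b) \<in> K \<times> B \<times> U (card F)" by auto
    then show ?case using insert.hyps by (force simp: U_def)
  qed
  have "S \<subseteq> (\<Union>n. U n)"
  proof
    fix x assume "x \<in> S"
    with span obtain F c where "finite F" "F \<subseteq> B" "c ` F \<subseteq> K" "x = (\<Sum>b\<in>F. c b * b)"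
      by metis
    with sum_U[of F c] show "x \<in> (\<Union>n. U n)" by auto
  qed
  moreover have "|\<Union>n. U n| \<le>o |B|"
    using assms(1) U by (intro card_of_UNION_ordLeq_infinite) (auto simp: infinite_iff_card_of_nat)
  ultimately show ?thesis using card_of_mono1 ordLeq_transitive by metis
qed

section \<open>Coordinates with finite support\<close>

text \<open>The direct sum of copies of \<open>K\<close> indexed by the type \<open>'i\<close>, in
  which coordinate vectors live.\<close>

definition finsupp :: "'b::zero set \<Rightarrow> ('i \<Rightarrow> 'b) set" where
  "finsupp K = {c. finite {i. c i \<noteq> 0} \<and> range c \<subseteq> K}"

definition lincomb :: "('i \<Rightarrow> 'b::semiring_0) \<Rightarrow> ('i \<Rightarrow> 'b) \<Rightarrow> 'b" where
  "lincomb b c = (\<Sum>i | c i \<noteq> 0. c i * b i)"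

text \<open>Vectors with different supports can be compared termwise once their sums run over a
  common finite index set.\<close>

lemma lincomb_superset:
  "finite S \<Longrightarrow> {i. c i \<noteq> 0} \<subseteq> S \<Longrightarrow> lincomb b c = (\<Sum>i\<in>S. c i * b i)"
  unfolding lincomb_def by (rule sum.mono_neutral_left) auto

lemma lincomb_add:
  assumes "c \<in> finsupp K" "d \<in> finsupp K'"
  shows "lincomb b (\<lambda>i. c i + d i) = lincomb b c + lincomb b d"
proof -
  let ?S = "{i. c i \<noteq> 0} \<union> {i. d i \<noteq> 0}"
  have "finite ?S" using assms by (simp add: finsupp_def)
  then have "lincomb b f = (\<Sum>i\<in>?S. f i * b i)" if "{i. f i \<noteq> 0} \<subseteq> ?S" for f
    using that by (rule lincomb_superset)
  moreover have "{i. c i + d i \<noteq> 0} \<subseteq> ?S" by auto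
  ultimately show ?thesis by (simp add: sum.distrib algebra_simps)
qed

lemma lincomb_scale:
  assumes "c \<in> finsupp K"
  shows "lincomb b (\<lambda>i. k * c i) = k * lincomb b c"
proof -
  have "lincomb b (\<lambda>i. k * c i) = (\<Sum>i | c i \<noteq> 0. k * c i * b i)"
    using assms by (intro lincomb_superset) (auto simp: finsupp_def)
  then show ?thesis by (simp add: lincomb_def sum_distrib_left mult.assoc)
qed

context subfield
begin

lemma finsupp_add: "c \<in> finsupp K \<Longrightarrow> d \<in> finsupp K \<Longrightarrow> (\<lambda>i. c i + d i) \<in> finsupp K"
  unfolding finsupp_def
  by (auto intro: add_mem finite_subset[where B = "{i. c i \<noteq> 0} \<union> {i. d i \<noteq> 0}"])

lemma finsupp_scale: "k \<in> K \<Longrightarrow> c \<in> finsupp K \<Longrightarrow> (\<lambda>i. k * c i) \<in> finsupp K"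
  unfolding finsupp_def
  by (auto intro: mult_mem elim!: finite_subset[rotated])

text \<open>Cardinality lets the field itself index the basis, so that bases over different
  subfields come with a common index set.\<close>

lemma basis_exists:
  assumes "countable K" "uncountable (UNIV :: 'a set)"
  obtains b :: "'a \<Rightarrow> 'a" where "bij_betw (lincomb b) (finsupp K) UNIV"
proof -
  obtain B where B: "indep B" "\<And>B'. indep B' \<Longrightarrow> B \<subseteq> B' \<Longrightarrow> B' = B"
    using maximal_indep_exists by blast
  have span: "\<exists>F c. finite F \<and> F \<subseteq> B \<and> c ` F \<subseteq> K \<and> x = (\<Sum>b\<in>F. c b * b)" for x
    using maximal_indep_spans[OF B] by metis
  \<comment> \<open>The bound is stated for supersets of \<open>B\<close> because \<open>B\<close>
    is not yet known to be infinite.\<close>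
  have le: "|UNIV :: 'a set| \<le>o |A|" if "infinite A" "B \<subseteq> A" for A
    using that(1) assms(1)
  proof (rule card_of_span_le)
    show "\<exists>F c. finite F \<and> F \<subseteq> A \<and> c ` F \<subseteq> K \<and> x = (\<Sum>b\<in>F. c b * b)" for x
      using span[of x] that(2) by blast
  qed
  have "infinite B"
  proof
    assume "finite B"
    text \<open>The cardinality bound needs an infinite set, so \<open>B\<close> is enlarged to a countably infinite one.\<close>
    obtain N :: "'a set" where N: "countable N" "infinite N"
      using infinite_countable_subset'[OF uncountable_infinite[OF assms(2)]] by auto
    then have "|UNIV :: 'a set| \<le>o |N \<union> B|" by (intro le) auto
    moreover have "|N \<union> B| \<le>o |UNIV :: nat set|"
      using N \<open>finite B\<close> by (simp add: countable_finite flip: countable_iff_card_of_nat)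
    ultimately show False
      using assms(2) unfolding countable_iff_card_of_nat by (metis ordLeq_transitive)
  qed
  then have "|UNIV :: 'a set| =o |B|"
    using le by (simp add: ordIso_iff_ordLeq card_of_mono1)
  then obtain g :: "'a \<Rightarrow> 'a" where g: "bij_betw g UNIV B"
    using card_of_ordIso by blast
  then have inj: "inj g" and range: "range g = B" by (auto simp: bij_betw_def)
  \<comment> \<open>Trivial kernel: reindexing along \<open>g\<close> turns a vanishing combination
    into a relation among elements of \<open>B\<close>.\<close>
  have zero: "c = (\<lambda>_. 0)" if c: "c \<in> finsupp K" "lincomb g c = 0" for c
  proof -
    have "c i = 0" for i
    proof (rule ccontr)
      assume i: "c i \<noteq> 0"
      have "(\<Sum>b\<in>g ` {i. c i \<noteq> 0}. c (inv g b) * b) = 0"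
        using inj by (simp add: sum.reindex inj_on_subset c(2)[unfolded lincomb_def])
      then have "c (inv g (g i)) = 0"
        using c(1) i range
        by (intro indepD[OF B(1), where F = "g ` {i. c i \<noteq> 0}" and c = "\<lambda>b. c (inv g b)"])
          (auto simp: finsupp_def)
      with i inj show False by simp
    qed
    then show ?thesis by auto
  qed
  have "bij_betw (lincomb g) (finsupp K) UNIV"
    unfolding bij_betw_def
  proof
    show "inj_on (lincomb g) (finsupp K)"
    proof (rule inj_onI)
      fix c d assume cd: "c \<in> finsupp K" "d \<in> finsupp K" "lincomb g c = lincomb g d"
      \<comment> \<open>The difference of \<open>c\<close> and \<open>d\<close> is written as a sum
        with a multiple by \<open>- 1\<close>, so that the rules for sums and scalings reduce
        injectivity to the trivial kernel.\<close>
      have d: "(\<lambda>i. - 1 * d i) \<in> finsupp K"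
        using cd(2) finsupp_scale one_mem uminus_mem by blast
      then have "(\<lambda>i. c i + - 1 * d i) = (\<lambda>_. 0)"
        using cd by (intro zero finsupp_add) (simp_all only: lincomb_add lincomb_scale, simp)
      then show "c = d" by (simp add: fun_eq_iff)
    qed
  next
    have "x \<in> lincomb g ` finsupp K" for x
    proof -
      obtain F c where F: "finite F" "F \<subseteq> B" "c ` F \<subseteq> K" "x = (\<Sum>b\<in>F. c b * b)"
        using span[of x] by metis
      \<comment> \<open>The coefficients are pulled back along \<open>g\<close> and extended by 0 to
        the whole index type.\<close>
      define d where "d i = (if g i \<in> F then c (g i) else 0)" for i
      have fin: "finite (g -` F)" using F(1) inj by (simp add: finite_vimageI)
      have supp: "{i. d i \<noteq> 0} \<subseteq> g -` F" by (auto simp: d_def)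
      have "lincomb g d = (\<Sum>i\<in>g -` F. c (g i) * g i)"
        by (subst lincomb_superset[OF fin supp]) (auto simp: d_def intro: sum.cong)
      also have "\<dots> = (\<Sum>b\<in>g ` (g -` F). c b * b)"
        using inj by (simp add: sum.reindex inj_on_subset del: image_vimage_eq)
      also have "g ` (g -` F) = F" using F(2) range by auto
      finally have "x = lincomb g d" using F(4) by simp
      moreover have "d \<in> finsupp K"
        using F(3) finite_subset[OF supp fin] zero_mem by (auto simp: finsupp_def d_def)
      ultimately show ?thesis by simp
    qed
    then show "lincomb g ` finsupp K = UNIV" by auto
  qed
  with that show thesis .
qed

end

section \<open>Semilinear bijections from field isomorphisms\<close>

text \<open>Both \<open>\<sigma>\<close> and its inverse fix 0, so applying either of them entrywise
  keeps supports finite.\<close>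

lemma bij_betw_comp_finsupp:
  assumes "bij_betw \<sigma> K K'" "\<sigma> 0 = 0" "0 \<in> K"
  shows "bij_betw ((\<circ>) \<sigma>) (finsupp K :: ('i \<Rightarrow> _) set) (finsupp K')"
proof (rule bij_betw_byWitness[where f' = "(\<circ>) (inv_into K \<sigma>)"])
  have inj: "inj_on \<sigma> K" and im: "\<sigma> ` K = K'" using assms(1) by (auto simp: bij_betw_def)
  have inv0: "inv_into K \<sigma> 0 = 0" using inv_into_f_f[OF inj assms(3)] assms(2) by simp
  show "\<forall>c\<in>finsupp K. inv_into K \<sigma> \<circ> (\<sigma> \<circ> c) = c"
    using inj by (auto simp: finsupp_def fun_eq_iff image_subset_iff)
  show "\<forall>c\<in>finsupp K'. \<sigma> \<circ> (inv_into K \<sigma> \<circ> c) = c"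
    using im by (auto simp: finsupp_def fun_eq_iff image_subset_iff f_inv_into_f)
  have "finite {i. \<sigma> (c i) \<noteq> 0}" if "finite {i. c i \<noteq> 0}" for c :: "'i \<Rightarrow> _"
    using assms(2) by (intro finite_subset[OF _ that]) auto
  then show "(\<circ>) \<sigma> ` finsupp K \<subseteq> (finsupp K' :: ('i \<Rightarrow> _) set)"
    using im by (auto simp: finsupp_def)
  have "finite {i. inv_into K \<sigma> (c i) \<noteq> 0}" if "finite {i. c i \<noteq> 0}" for c :: "'i \<Rightarrow> _"
    using inv0 by (intro finite_subset[OF _ that]) auto
  then show "(\<circ>) (inv_into K \<sigma>) ` finsupp K' \<subseteq> (finsupp K :: ('i \<Rightarrow> _) set)"
    using im by (auto simp: finsupp_def image_subset_iff intro: inv_into_into)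
qed

text \<open>Take coordinates in a basis over \<open>K\<close>, apply \<open>\<sigma>\<close> to
  each, and recombine with a basis over \<open>K'\<close>. This makes sense because both bases are
  indexed by the ambient field.\<close>

lemma semilinear_bijection_exists:
  fixes K K' :: "'a::field set"
  assumes "subfield K" "subfield K'" "countable K" "uncountable (UNIV :: 'a set)"
    and bij: "bij_betw \<sigma> K K'"
    and add: "\<And>x y. x \<in> K \<Longrightarrow> y \<in> K \<Longrightarrow> \<sigma> (x + y) = \<sigma> x + \<sigma> y"
    and mult: "\<And>x y. x \<in> K \<Longrightarrow> y \<in> K \<Longrightarrow> \<sigma> (x * y) = \<sigma> x * \<sigma> y"
  obtains \<xi> :: "'a \<Rightarrow> 'a" where "bij \<xi>" "\<And>x y. \<xi> (x + y) = \<xi> x + \<xi> y"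
    "\<And>k x. k \<in> K \<Longrightarrow> \<xi> (k * x) = \<sigma> k * \<xi> x"
proof -
  interpret K: subfield K by fact
  interpret K': subfield K' by fact
  have "countable K'"
    using bij \<open>countable K\<close> by (metis bij_betw_def countable_image)
  then obtain b' :: "'a \<Rightarrow> 'a" where b': "bij_betw (lincomb b') (finsupp K') UNIV"
    using K'.basis_exists assms(4) by blast
  obtain b :: "'a \<Rightarrow> 'a" where b: "bij_betw (lincomb b) (finsupp K) UNIV"
    using K.basis_exists assms(3,4) by blast
  have \<sigma>0: "\<sigma> 0 = 0" using add[OF K.zero_mem K.zero_mem] by (metis add_0 add_cancel_left_left)
  have comp: "bij_betw ((\<circ>) \<sigma>) (finsupp K :: ('a \<Rightarrow> 'a) set) (finsupp K')"
    using bij \<sigma>0 K.zero_mem by (rule bij_betw_comp_finsupp)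
  define \<xi> where "\<xi> = lincomb b' \<circ> ((\<circ>) \<sigma> \<circ> inv_into (finsupp K) (lincomb b))"
  have \<xi>: "\<xi> (lincomb b c) = lincomb b' (\<sigma> \<circ> c)" if "c \<in> finsupp K" for c
    using that b by (simp add: \<xi>_def bij_betw_def)
  have ex: "\<exists>c\<in>finsupp K. x = lincomb b c" for x
    using b by (auto simp: bij_betw_def)
  have comp_mem: "\<sigma> \<circ> c \<in> finsupp K'" if "c \<in> finsupp K" for c :: "'a \<Rightarrow> 'a"
    using comp that by (auto simp: bij_betw_def)
  have range: "c i \<in> K" if "c \<in> finsupp K" for c :: "'a \<Rightarrow> 'a" and i
    using that by (auto simp: finsupp_def)
  show thesis
  proof
    show "bij \<xi>"
      unfolding \<xi>_def by (rule bij_betw_trans[OF bij_betw_trans[OF bij_betw_inv_into[OF b] comp] b'])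
    show "\<xi> (x + y) = \<xi> x + \<xi> y" for x y
    proof -
      obtain c d where cd: "c \<in> finsupp K" "d \<in> finsupp K" "x = lincomb b c" "y = lincomb b d"
        using ex by metis
      have "\<xi> (x + y) = lincomb b' (\<lambda>i. (\<sigma> \<circ> c) i + (\<sigma> \<circ> d) i)"
        using cd by (simp add: lincomb_add[symmetric] \<xi> K.finsupp_add o_def add range)
      also have "\<dots> = \<xi> x + \<xi> y"
        by (simp only: cd(3,4) \<xi>[OF cd(1)] \<xi>[OF cd(2)]
            lincomb_add[OF comp_mem[OF cd(1)] comp_mem[OF cd(2)]])
      finally show ?thesis .
    qed
    show "\<xi> (k * x) = \<sigma> k * \<xi> x" if k: "k \<in> K" for k x
    proof -
      obtain c where c: "c \<in> finsupp K" "x = lincomb b c"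
        using ex by metis
      have "\<xi> (k * x) = lincomb b' (\<lambda>i. \<sigma> k * (\<sigma> \<circ> c) i)"
        using c k by (simp add: lincomb_scale[symmetric] \<xi> K.finsupp_scale o_def mult range)
      also have "\<dots> = \<sigma> k * \<xi> x"
        by (simp only: c(2) \<xi>[OF c(1)] lincomb_scale[OF comp_mem[OF c(1)]])
      finally show ?thesis .
    qed
  qed
qed

subsection \<open>Simple extensions of the rationals\<close>

definition rat_eval :: "'a::field_char_0 \<Rightarrow> rat poly \<Rightarrow> 'a" where
  "rat_eval x p = poly (map_poly of_rat p) x"

lemma map_poly_of_rat_add:
  "map_poly of_rat (p + q) = (map_poly of_rat p + map_poly of_rat q :: 'a::field_char_0 poly)"
  by (intro poly_eqI) (simp add: coeff_map_poly of_rat_add)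

lemma map_poly_of_rat_diff:
  "map_poly of_rat (p - q) = (map_poly of_rat p - map_poly of_rat q :: 'a::field_char_0 poly)"
  by (intro poly_eqI) (simp add: coeff_map_poly of_rat_diff)

lemma map_poly_of_rat_mult:
  "map_poly of_rat (p * q) = (map_poly of_rat p * map_poly of_rat q :: 'a::field_char_0 poly)"
  by (intro poly_eqI) (simp add: coeff_map_poly coeff_mult of_rat_sum of_rat_mult)

lemma rat_eval_simps [simp]:
  "rat_eval x 0 = 0" "rat_eval x 1 = 1" "rat_eval x [:0, 1:] = x"
  "rat_eval x (p + q) = rat_eval x p + rat_eval x q"
  "rat_eval x (p - q) = rat_eval x p - rat_eval x q"
  "rat_eval x (p * q) = rat_eval x p * rat_eval x q"
  by (simp_all add: rat_eval_def map_poly_of_rat_add map_poly_of_rat_diff map_poly_of_rat_mult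
      map_poly_pCons)

lemma rat_eval_pCons: "rat_eval x (pCons a p) = of_rat a + x * rat_eval x p"
  by (simp add: rat_eval_def map_poly_pCons)

text \<open>The field generated by \<open>x\<close>. Quotients of polynomial values are used so that
  algebraic and transcendental \<open>x\<close> are treated alike.\<close>

definition rat_adjoin :: "'a::field_char_0 \<Rightarrow> 'a set" where
  "rat_adjoin x = {rat_eval x p / rat_eval x q | p q. rat_eval x q \<noteq> 0}"

lemma rat_adjoinI: "rat_eval x q \<noteq> 0 \<Longrightarrow> rat_eval x p / rat_eval x q \<in> rat_adjoin x"
  unfolding rat_adjoin_def by blast

lemma rat_adjoinE:
  assumes "y \<in> rat_adjoin x"
  obtains p q where "y = rat_eval x p / rat_eval x q" "rat_eval x q \<noteq> 0"
  using assms unfolding rat_adjoin_def by blast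

lemma self_mem_rat_adjoin: "x \<in> rat_adjoin x"
  using rat_adjoinI[of x 1 "[:0, 1:]"] by simp

lemma subfield_rat_adjoin: "subfield (rat_adjoin x)"
proof
  show "1 \<in> rat_adjoin x"
    using rat_adjoinI[of x 1 1] by simp
next
  fix y z assume "y \<in> rat_adjoin x" "z \<in> rat_adjoin x"
  then obtain p q r s where
    y: "y = rat_eval x p / rat_eval x q" "rat_eval x q \<noteq> 0" and
    z: "z = rat_eval x r / rat_eval x s" "rat_eval x s \<noteq> 0"
    by (elim rat_adjoinE)
  show "y - z \<in> rat_adjoin x"
    using rat_adjoinI[of x "q * s" "p * s - r * q"] y z by (simp add: diff_frac_eq)
  show "y * z \<in> rat_adjoin x"
    using rat_adjoinI[of x "q * s" "p * r"] y z by simp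
next
  fix y assume "y \<in> rat_adjoin x"
  then obtain p q where y: "y = rat_eval x p / rat_eval x q" "rat_eval x q \<noteq> 0"
    by (elim rat_adjoinE)
  show "inverse y \<in> rat_adjoin x"
    \<comment> \<open>If the numerator vanishes, then \<open>y = 0\<close> and its inverse is 0 by
      convention, represented as 0 over 1.\<close>
    using rat_adjoinI[of x p q] rat_adjoinI[of x 1 0] y by (cases "rat_eval x p = 0") auto
qed

text \<open>Elements are named by pairs of rational polynomials, and these are countable through
  their coefficient lists.\<close>

lemma countable_rat_adjoin: "countable (rat_adjoin x)"
proof -
  have "inj (coeffs :: rat poly \<Rightarrow> rat list)"
    by (simp add: inj_def coeffs_eq_iff)
  then have "countable (UNIV :: rat poly set)"
    by (rule countableI'[OF inj_compose[OF inj_to_nat]])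
  then have "countable ((UNIV :: rat poly set) \<times> (UNIV :: rat poly set))"
    by blast
  moreover have "rat_adjoin x \<subseteq> (\<lambda>(p, q). rat_eval x p / rat_eval x q) ` (UNIV \<times> UNIV)"
    by (auto simp: rat_adjoin_def)
  ultimately show ?thesis
    using countable_image countable_subset by blast
qed

text \<open>Cross-multiplied, equality of two fractions says that one rational polynomial vanishes
  at the point. Vanishing at \<open>x\<close> and at \<open>y\<close> agree, which makes the map of
  fractions both well defined and injective.\<close>

lemma rat_adjoin_isomorphism:
  fixes x y :: "'a::field_char_0"
  assumes "\<And>p. rat_eval x p = 0 \<longleftrightarrow> rat_eval y p = 0"
  obtains \<sigma> where "bij_betw \<sigma> (rat_adjoin x) (rat_adjoin y)" "\<sigma> x = y"
    "\<And>u v. u \<in> rat_adjoin x \<Longrightarrow> v \<in> rat_adjoin x \<Longrightarrow> \<sigma> (u + v) = \<sigma> u + \<sigma> v"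
    "\<And>u v. u \<in> rat_adjoin x \<Longrightarrow> v \<in> rat_adjoin x \<Longrightarrow> \<sigma> (u * v) = \<sigma> u * \<sigma> v"
proof -
  have cong: "rat_eval x p / rat_eval x q = rat_eval x r / rat_eval x s \<longleftrightarrow>
      rat_eval y p / rat_eval y q = rat_eval y r / rat_eval y s"
    if "rat_eval x q \<noteq> 0" "rat_eval x s \<noteq> 0" for p q r s
    using that assms[of "p * s - r * q"] assms[of q] assms[of s]
    by (simp add: frac_eq_eq)
  \<comment> \<open>An arbitrary representation as a fraction is chosen; by \<open>cong\<close> the
    value of \<open>\<sigma>\<close> does not depend on it.\<close>
  define num_den where
    "num_den u = (SOME (p, q). rat_eval x q \<noteq> 0 \<and> u = rat_eval x p / rat_eval x q)" for u
  define \<sigma> where "\<sigma> u = (case num_den u of (p, q) \<Rightarrow> rat_eval y p / rat_eval y q)" for u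
  have \<sigma>: "\<sigma> (rat_eval x p / rat_eval x q) = rat_eval y p / rat_eval y q"
    if q: "rat_eval x q \<noteq> 0" for p q
  proof -
    let ?u = "rat_eval x p / rat_eval x q"
    have "\<exists>r. case r of (r, s) \<Rightarrow> rat_eval x s \<noteq> 0 \<and> ?u = rat_eval x r / rat_eval x s"
      using q by auto
    then have "case num_den ?u of (r, s) \<Rightarrow> rat_eval x s \<noteq> 0 \<and> ?u = rat_eval x r / rat_eval x s"
      unfolding num_den_def by (rule someI_ex)
    then show ?thesis
      using cong[OF q] by (auto simp: \<sigma>_def split: prod.splits)
  qed
  show thesis
  proof
    show "bij_betw \<sigma> (rat_adjoin x) (rat_adjoin y)"
      unfolding bij_betw_def
    proof
      show "inj_on \<sigma> (rat_adjoin x)"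
        by (rule inj_onI) (auto elim!: rat_adjoinE simp: \<sigma> cong)
      show "\<sigma> ` rat_adjoin x = rat_adjoin y"
        unfolding rat_adjoin_def using assms \<sigma> by (force simp: image_iff)
    qed
    show "\<sigma> x = y"
      using \<sigma>[of 1 "[:0, 1:]"] by simp
  next
    fix u v assume "u \<in> rat_adjoin x" "v \<in> rat_adjoin x"
    then obtain p q r s where
      u: "u = rat_eval x p / rat_eval x q" "rat_eval x q \<noteq> 0" and
      v: "v = rat_eval x r / rat_eval x s" "rat_eval x s \<noteq> 0"
      by (elim rat_adjoinE)
    show "\<sigma> (u + v) = \<sigma> u + \<sigma> v"
      using \<sigma>[of "q * s" "p * s + r * q"] u v assms[of q] assms[of s] by (simp add: \<sigma> add_frac_eq)
    show "\<sigma> (u * v) = \<sigma> u * \<sigma> v"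
      using \<sigma>[of "q * s" "p * r"] u v by (simp add: \<sigma>)
  qed
qed

subsection \<open>Rational annihilators\<close>

text \<open>The minimal polynomial, nonzero because monic, is the witness in one direction; in the
  other, \<open>of_rat\<close> is injective and so keeps \<open>p\<close> nonzero.\<close>

lemma algebraic_iff_rat_eval: "algebraic x \<longleftrightarrow> (\<exists>p. p \<noteq> 0 \<and> rat_eval x p = 0)"
proof
  assume "algebraic x"
  then show "\<exists>p. p \<noteq> 0 \<and> rat_eval x p = 0"
    using is_min_poly_min_poly[of x] unfolding is_min_poly_def rat_eval_def
    by (metis leading_coeff_0_iff zero_neq_one)
next
  assume "\<exists>p. p \<noteq> 0 \<and> rat_eval x p = 0"
  then obtain p where "p \<noteq> 0" "rat_eval x p = 0" by blast
  then show "algebraic x"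
    by (intro algebraicI'[of "map_poly of_rat p"]) (auto simp: coeff_map_poly rat_eval_def poly_eq_iff)
qed

text \<open>The remainder of an annihilating polynomial modulo the minimal one also annihilates
  \<open>x\<close>, so minimality of the degree makes it zero.\<close>

lemma rat_eval_eq_0_iff_min_poly_dvd:
  assumes "algebraic x"
  shows "rat_eval x p = 0 \<longleftrightarrow> min_poly x dvd p"
proof
  let ?m = "min_poly x"
  have m: "lead_coeff ?m = 1" "rat_eval x ?m = 0"
    and min: "\<And>q. q \<noteq> 0 \<Longrightarrow> rat_eval x q = 0 \<Longrightarrow> degree ?m \<le> degree q"
    using is_min_poly_min_poly[OF assms] by (auto simp: is_min_poly_def rat_eval_def)
  show "rat_eval x p = 0" if "?m dvd p"
    using that m(2) by auto
  assume "rat_eval x p = 0"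
  then have "rat_eval x (p mod ?m) = 0"
    using m(2) by (simp flip: minus_div_mult_eq_mod)
  moreover have "?m \<noteq> 0" using m(1) by auto
  ultimately have "p mod ?m = 0"
    using min degree_mod_less[of ?m p] by fastforce
  then show "?m dvd p" by (simp add: dvd_eq_mod_eq_0)
qed

text \<open>The annihilating polynomials are the multiples of the minimal polynomial for an
  algebraic number, and only 0 for a transcendental one.\<close>

lemma same_rat_annihilator_iff:
  fixes x y :: "'a::field_char_0"
  shows "(\<forall>p. rat_eval x p = 0 \<longleftrightarrow> rat_eval y p = 0) \<longleftrightarrow>
    (\<not> algebraic x \<and> \<not> algebraic y) \<or> (algebraic x \<and> algebraic y \<and> galois_conjugates x y)"
    (is "?same \<longleftrightarrow> ?alg")
proof
  assume ?same
  \<comment> \<open>\<open>is_min_poly\<close> sees its point only through the polynomials vanishing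
    there, so the two descriptions coincide, even where \<open>min_poly\<close> is
    unspecified.\<close>
  then have "min_poly x = min_poly y" "algebraic x \<longleftrightarrow> algebraic y"
    by (simp_all add: min_poly_def is_min_poly_def algebraic_iff_rat_eval flip: rat_eval_def)
  then show ?alg by (auto simp: galois_conjugates_def)
next
  assume ?alg
  then show ?same
  proof (elim disjE conjE)
    assume "\<not> algebraic x" "\<not> algebraic y"
    then show ?same by (metis algebraic_iff_rat_eval rat_eval_simps(1))
  qed (simp add: rat_eval_eq_0_iff_min_poly_dvd galois_conjugates_def)
qed

subsection \<open>Additive conjugations of integer representations\<close>

text \<open>Additivity yields compatibility with natural, then integer multiples; a rational factor
  follows by clearing its denominator.\<close>

lemma additive_of_rat_mult:
  fixes \<xi> :: "'a::field_char_0 \<Rightarrow> 'b::field_char_0"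
  assumes "\<And>x y. \<xi> (x + y) = \<xi> x + \<xi> y"
  shows "\<xi> (of_rat r * x) = of_rat r * \<xi> x"
proof -
  interpret additive \<xi> by standard (rule assms)
  have nat: "\<xi> (of_nat n * y) = of_nat n * \<xi> y" for n y
    by (induction n) (simp_all add: zero add algebra_simps)
  have int: "\<xi> (of_int k * y) = of_int k * \<xi> y" for k y
    by (cases k rule: int_cases2) (simp_all add: nat minus)
  obtain a b where r: "r = Rat.Fract a b" "b > 0"
    by (cases r)
  have "of_int b * \<xi> (of_rat r * x) = \<xi> (of_int b * (of_rat r * x))"
    by (simp only: int)
  also have "\<dots> = \<xi> (of_int a * x)"
    using r by (simp add: of_rat_rat)
  also have "\<dots> = of_int b * (of_rat r * \<xi> x)"
    using r by (simp add: of_rat_rat int)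
  finally show ?thesis using r(2) by simp
qed

text \<open>Horner's scheme: rational coefficients pass through \<open>\<xi>\<close> by additivity,
  and each factor \<open>z\<close> becomes \<open>w\<close>.\<close>

lemma additive_rat_eval_mult:
  fixes \<xi> :: "'a::field_char_0 \<Rightarrow> 'b::field_char_0"
  assumes add: "\<And>x y. \<xi> (x + y) = \<xi> x + \<xi> y" and z: "\<And>x. \<xi> (z * x) = w * \<xi> x"
  shows "\<xi> (rat_eval z p * x) = rat_eval w p * \<xi> x"
proof (induction p)
  case 0
  interpret additive \<xi> by standard (rule add)
  show ?case by (simp add: zero)
next
  case (pCons a p)
  then show ?case
    by (simp add: rat_eval_pCons distrib_right add additive_of_rat_mult[OF add] mult.assoc z)
qed

text \<open>The group of integers is generated by 1, so intertwining the action of 1 is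
  enough.\<close>

lemma additive_conjugates_int_rep_iff:
  assumes "z \<noteq> 0" "w \<noteq> 0"
  shows "additive_conjugates (int_rep z) (int_rep w) \<longleftrightarrow>
    (\<exists>\<xi>. bij \<xi> \<and> (\<forall>x y. \<xi> (x + y) = \<xi> x + \<xi> y) \<and> (\<forall>x. \<xi> (z * x) = w * \<xi> x))"
proof -
  have "(\<forall>n x. \<xi> (z powi n * x) = w powi n * \<xi> x) \<longleftrightarrow> (\<forall>x. \<xi> (z * x) = w * \<xi> x)"
    (is "?all \<longleftrightarrow> ?one") for \<xi> :: "complex \<Rightarrow> complex"
  proof
    assume ?all
    then show ?one by (metis power_int_1_right)
  next
    assume one: ?one
    have nat: "\<xi> (z ^ n * x) = w ^ n * \<xi> x" for n x
      by (induction n) (simp_all add: one mult.assoc)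
    \<comment> \<open>The rule for \<open>n\<close>-th powers is applied to
      \<open>inverse (z ^ n) * x\<close>, and \<open>w ^ n\<close> is then divided out.\<close>
    have neg: "\<xi> (inverse (z ^ n) * x) = inverse (w ^ n) * \<xi> x" for n x
      using nat[of n "inverse (z ^ n) * x"] assms by (simp add: field_simps)
    show ?all
      using nat neg by (auto simp: power_int_def power_inverse)
  qed
  then show ?thesis
    unfolding additive_conjugates_def int_rep_def by simp
qed

theorem corollary18:
  fixes z w :: complex
  assumes "norm z = 1" and "norm w = 1"
  shows "additive_conjugates (int_rep z) (int_rep w) \<longleftrightarrow>
    (\<not> algebraic z \<and> \<not> algebraic w) \<or>
    (algebraic z \<and> algebraic w \<and> galois_conjugates z w)"
proof -
  have nz: "z \<noteq> 0" "w \<noteq> 0" using assms by auto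
  have "additive_conjugates (int_rep z) (int_rep w) \<longleftrightarrow>
      (\<forall>p. rat_eval z p = 0 \<longleftrightarrow> rat_eval w p = 0)" (is "_ \<longleftrightarrow> ?same")
    unfolding additive_conjugates_int_rep_iff[OF nz]
  proof
    assume "\<exists>\<xi>. bij \<xi> \<and> (\<forall>x y. \<xi> (x + y) = \<xi> x + \<xi> y) \<and> (\<forall>x. \<xi> (z * x) = w * \<xi> x)"
    then obtain \<xi> where \<xi>: "bij \<xi>" "\<And>x y. \<xi> (x + y) = \<xi> x + \<xi> y" "\<And>x. \<xi> (z * x) = w * \<xi> x"
      by blast
    interpret additive \<xi> by standard (rule \<xi>(2))
    have \<xi>_eq_0: "\<xi> x = 0 \<longleftrightarrow> x = 0" for x
      using \<xi>(1) zero by (metis bij_pointE)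
    \<comment> \<open>Testing on the vector 1 gives
      \<open>\<xi> (rat_eval z p) = rat_eval w p * \<xi> 1\<close>, where \<open>\<xi> 1\<close> is
      nonzero.\<close>
    show ?same
      using additive_rat_eval_mult[of \<xi> z w _ 1, OF \<xi>(2,3)] \<xi>_eq_0
      by (metis mult_eq_0_iff zero_neq_one)
  next
    assume ?same
    then obtain \<sigma> where \<sigma>: "bij_betw \<sigma> (rat_adjoin z) (rat_adjoin w)" "\<sigma> z = w"
      "\<And>u v. u \<in> rat_adjoin z \<Longrightarrow> v \<in> rat_adjoin z \<Longrightarrow> \<sigma> (u + v) = \<sigma> u + \<sigma> v"
      "\<And>u v. u \<in> rat_adjoin z \<Longrightarrow> v \<in> rat_adjoin z \<Longrightarrow> \<sigma> (u * v) = \<sigma> u * \<sigma> v"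
      using rat_adjoin_isomorphism[of z w] by blast
    obtain \<xi> where "bij \<xi>" "\<And>x y. \<xi> (x + y) = \<xi> x + \<xi> y"
      "\<And>k x. k \<in> rat_adjoin z \<Longrightarrow> \<xi> (k * x) = \<sigma> k * \<xi> x"
      using semilinear_bijection_exists[OF subfield_rat_adjoin subfield_rat_adjoin
          countable_rat_adjoin uncountable_UNIV_complex \<sigma>(1,3,4)] by metis
    \<comment> \<open>Semilinearity at the scalar \<open>z\<close>, which \<open>\<sigma>\<close>
      sends to \<open>w\<close>, is the intertwining relation.\<close>
    with \<sigma>(2) self_mem_rat_adjoin
    show "\<exists>\<xi>. bij \<xi> \<and> (\<forall>x y. \<xi> (x + y) = \<xi> x + \<xi> y) \<and> (\<forall>x. \<xi> (z * x) = w * \<xi> x)"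
      by metis
  qed
  then show ?thesis
    by (simp only: same_rat_annihilator_iff)
qed

end
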